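(* Every quadratic map between groups $f:G\to H$ induces a commutative diagram of group homomorphisms with exact rows $$\begin{array}{ccccccccc}0&\to&\gamma_3(G)&\xrightarrow{\,q_3\,}&Q(G)&\xrightarrow{\,Q(\pi_G)\,}&Q(\overline G)&\to&0\\&&\downarrow{\scriptstyle f_3}&&\downarrow{\scriptstyle\overline f}&&\downarrow{\scriptstyle\overline{\overline f}}&&\\0&\to&\gamma_3(H)&\longrightarrow&H&\xrightarrow{\,\pi_H\,}&\overline H&\to&0\end{array}$$ where $q_3$ is the restriction of the universal quadratic map $q:G\to Q(G)$ to $\gamma_3(G)$, $\gamma_3(H)\to H$ is the inclusion, and $\overline f$ is the homomorphism with $\overline f\circ q=f$.
   Context: Groups are written additively but need not be abelian, and $0$ denotes the trivial group. A map $f:G\to H$ between groups is quadratic if the map $d_f:G\times G\to H$, $d_f(a,b)=f(a+b)-f(b)-f(a)$, is a group homomorphism in each variable, with values commuting with all elements of $f(G)$. The universal quadratic map on $G$ is a quadratic map $q:G\to Q(G)$ into a group $Q(G)$ such that every quadratic map $f:G\to H$ factors as $f=\overline f\circ q$ for a unique group homomorphism $\overline f:Q(G)\to H$; it exists and is unique up to unique isomorphism, and $Q$ is a functor on groups ($Q(\alpha)$ being the homomorphism with $Q(\alpha)\circ q=q\circ\alpha$ for a homomorphism $\alpha$). $[a,b]=a+b-a-b$, $\gamma_3(G)=[G,[G,G]]$ is the third term of the lower central series, $\overline G=G/\gamma_3(G)$, and $\pi_G:G\to\overline G$ is the canonical projection (similarly for $H$). *)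

theory Defs
  imports "HOL-Algebra.Generated_Groups" "HOL-Algebra.Coset" "HOL-Library.FuncSet"
begin

section \<open>Lower central series and short exact sequences\<close>

text \<open>Groups are HOL-Algebra groups, hence written multiplicatively.\<close>

definition commutator :: "('a, 'm) monoid_scheme \<Rightarrow> 'a \<Rightarrow> 'a \<Rightarrow> 'a" where
  "commutator G a b = a \<otimes>\<^bsub>G\<^esub> b \<otimes>\<^bsub>G\<^esub> inv\<^bsub>G\<^esub> a \<otimes>\<^bsub>G\<^esub> inv\<^bsub>G\<^esub> b"

definition gamma3 :: "('a, 'm) monoid_scheme \<Rightarrow> 'a set" where
  "gamma3 G = generate G {commutator G a b | a b. a \<in> carrier G \<and> b \<in> derived G (carrier G)}"

abbreviation gamma3_group :: "'a monoid \<Rightarrow> 'a monoid" where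
  "gamma3_group G \<equiv> G\<lparr>carrier := gamma3 G\<rparr>"

abbreviation gamma3_quotient :: "'a monoid \<Rightarrow> 'a set monoid" where
  "gamma3_quotient G \<equiv> G Mod gamma3 G"

definition gamma3_proj :: "'a monoid \<Rightarrow> 'a \<Rightarrow> 'a set" where
  "gamma3_proj G x = gamma3 G #>\<^bsub>G\<^esub> x"

definition short_exact ::
  "'a monoid \<Rightarrow> ('a \<Rightarrow> 'b) \<Rightarrow> 'b monoid \<Rightarrow> ('b \<Rightarrow> 'c) \<Rightarrow> 'c monoid \<Rightarrow> bool" where
  "short_exact A i B p C \<longleftrightarrow>
     group A \<and> group B \<and> group C \<and>
     i \<in> mon A B \<and> i ` carrier A = kernel B C p \<and> p \<in> epi B C"

section \<open>Quadratic maps\<close>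

definition deviation ::
  "('a, 'm) monoid_scheme \<Rightarrow> ('b, 'n) monoid_scheme \<Rightarrow> ('a \<Rightarrow> 'b) \<Rightarrow> 'a \<Rightarrow> 'a \<Rightarrow> 'b" where
  "deviation G H f a b = f (a \<otimes>\<^bsub>G\<^esub> b) \<otimes>\<^bsub>H\<^esub> inv\<^bsub>H\<^esub> f b \<otimes>\<^bsub>H\<^esub> inv\<^bsub>H\<^esub> f a"

definition quadratic_map ::
  "('a, 'm) monoid_scheme \<Rightarrow> ('b, 'n) monoid_scheme \<Rightarrow> ('a \<Rightarrow> 'b) \<Rightarrow> bool" where
  "quadratic_map G H f \<longleftrightarrow>
     f \<in> carrier G \<rightarrow> carrier H \<and>
     (\<forall>b\<in>carrier G. (\<lambda>a. deviation G H f a b) \<in> hom G H) \<and>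
     (\<forall>a\<in>carrier G. (\<lambda>b. deviation G H f a b) \<in> hom G H) \<and>
     (\<forall>a\<in>carrier G. \<forall>b\<in>carrier G. \<forall>c\<in>carrier G.
        deviation G H f a b \<otimes>\<^bsub>H\<^esub> f c = f c \<otimes>\<^bsub>H\<^esub> deviation G H f a b)"

section \<open>The universal quadratic map\<close>

text \<open>HOL-Algebra homomorphisms are unconstrained outside the carrier; uniqueness is therefore
  expressed among extensional functions.\<close>

definition quadratic_universal_for ::
  "'h itself \<Rightarrow> 'a monoid \<Rightarrow> 'q monoid \<Rightarrow> ('a \<Rightarrow> 'q) \<Rightarrow> bool" where
  "quadratic_universal_for _ G QG q \<longleftrightarrow>
     (\<forall>(H :: 'h monoid) f. group H \<and> quadratic_map G H f \<longrightarrow>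
        (\<exists>!\<phi>. \<phi> \<in> hom QG H \<and> \<phi> \<in> extensional (carrier QG) \<and>
              (\<forall>x\<in>carrier G. \<phi> (q x) = f x)))"

text \<open>A definition cannot quantify over the types carrying the target groups, so the universal
  property is demanded only for two of them: the type carrying \<^term>\<open>QG\<close>, and one that is large
  enough to carry a quotient of the free group on \<^term>\<open>G\<close>. Neither alone would suffice, but
  together they imply the universal property for target groups over every type, which is
  \<open>universal_quadratic_map_all_types\<close> below. Existence is \<open>universal_quadratic_map_exists\<close>.\<close>

type_synonym 'a signed_word = "(bool \<times> 'a) list"

definition universal_quadratic_map :: "'a monoid \<Rightarrow> 'q monoid \<Rightarrow> ('a \<Rightarrow> 'q) \<Rightarrow> bool" where
  "universal_quadratic_map G QG q \<longleftrightarrow>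
     group QG \<and> quadratic_map G QG q \<and>
     quadratic_universal_for TYPE('q) G QG q \<and>
     quadratic_universal_for TYPE('a signed_word set) G QG q"

definition quadratic_lift ::
  "'a monoid \<Rightarrow> 'q monoid \<Rightarrow> ('a \<Rightarrow> 'q) \<Rightarrow> 'h monoid \<Rightarrow> ('a \<Rightarrow> 'h) \<Rightarrow> 'q \<Rightarrow> 'h" where
  "quadratic_lift G QG q H f =
     (THE \<phi>. \<phi> \<in> hom QG H \<and> \<phi> \<in> extensional (carrier QG) \<and>
             (\<forall>x\<in>carrier G. \<phi> (q x) = f x))"

definition Q_map ::
  "'a monoid \<Rightarrow> 'q monoid \<Rightarrow> ('a \<Rightarrow> 'q) \<Rightarrow> 'r monoid \<Rightarrow> ('b \<Rightarrow> 'r) \<Rightarrow> ('a \<Rightarrow> 'b) \<Rightarrow> 'q \<Rightarrow> 'r" where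
  "Q_map G QG q QK k \<alpha> = quadratic_lift G QG q QK (k \<circ> \<alpha>)"

lemma quadratic_universal_forD:
  fixes H :: "'h monoid"
  assumes "quadratic_universal_for TYPE('h) G QG q" "group H" "quadratic_map G H f"
  shows "\<exists>!\<phi>. \<phi> \<in> hom QG H \<and> \<phi> \<in> extensional (carrier QG) \<and> (\<forall>x\<in>carrier G. \<phi> (q x) = f x)"
  using assms(1)[unfolded quadratic_universal_for_def, rule_format, of H f] assms(2,3) by simp

section \<open>Existence, and independence of the carrier types\<close>

text \<open>\<open>presented_Q G\<close> is given by generators and relations: words in signed elements of
  \<open>G\<close> (\<open>(False, x)\<close> is the inverse of the generator \<open>(True, x)\<close>) modulo the congruence \<open>qcong\<close>
  generated by free cancellation and the three conditions on a quadratic map.\<close>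

definition sword_dev :: "('a, 'm) monoid_scheme \<Rightarrow> 'a \<Rightarrow> 'a \<Rightarrow> 'a signed_word" where
  "sword_dev G a b = [(True, a \<otimes>\<^bsub>G\<^esub> b), (False, b), (False, a)]"

definition swords :: "('a, 'm) monoid_scheme \<Rightarrow> 'a signed_word set" where
  "swords G = lists (UNIV \<times> carrier G)"

inductive qcong :: "('a, 'm) monoid_scheme \<Rightarrow> 'a signed_word \<Rightarrow> 'a signed_word \<Rightarrow> bool"
  for G where
  refl: "u \<in> swords G \<Longrightarrow> qcong G u u"
| sym: "qcong G u v \<Longrightarrow> qcong G v u"
| trans: "qcong G u v \<Longrightarrow> qcong G v w \<Longrightarrow> qcong G u w"
| app: "qcong G u v \<Longrightarrow> qcong G u' v' \<Longrightarrow> qcong G (u @ u') (v @ v')"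
| cancel: "x \<in> carrier G \<Longrightarrow> qcong G [(s, x), (\<not> s, x)] []"
| left: "a \<in> carrier G \<Longrightarrow> a' \<in> carrier G \<Longrightarrow> b \<in> carrier G \<Longrightarrow>
    qcong G (sword_dev G (a \<otimes>\<^bsub>G\<^esub> a') b) (sword_dev G a b @ sword_dev G a' b)"
| right: "a \<in> carrier G \<Longrightarrow> b \<in> carrier G \<Longrightarrow> b' \<in> carrier G \<Longrightarrow>
    qcong G (sword_dev G a (b \<otimes>\<^bsub>G\<^esub> b')) (sword_dev G a b @ sword_dev G a b')"
| comm: "a \<in> carrier G \<Longrightarrow> b \<in> carrier G \<Longrightarrow> c \<in> carrier G \<Longrightarrow>
    qcong G (sword_dev G a b @ [(True, c)]) ([(True, c)] @ sword_dev G a b)"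

definition qclass :: "('a, 'm) monoid_scheme \<Rightarrow> 'a signed_word \<Rightarrow> 'a signed_word set" where
  "qclass G u = {v. qcong G u v}"

definition presented_Q :: "'a monoid \<Rightarrow> 'a signed_word set monoid" where
  "presented_Q G = \<lparr>carrier = qclass G ` swords G,
     mult = (\<lambda>A B. {w. \<exists>u\<in>A. \<exists>v\<in>B. qcong G (u @ v) w}),
     one = qclass G []\<rparr>"

definition presented_q :: "'a monoid \<Rightarrow> 'a \<Rightarrow> 'a signed_word set" where
  "presented_q G x = qclass G [(True, x)]"

definition sword_eval ::
  "('b, 'n) monoid_scheme \<Rightarrow> ('a \<Rightarrow> 'b) \<Rightarrow> 'a signed_word \<Rightarrow> 'b" where
  "sword_eval H f w =
     foldr (\<lambda>(s, x) r. (if s then f x else inv\<^bsub>H\<^esub> f x) \<otimes>\<^bsub>H\<^esub> r) w \<one>\<^bsub>H\<^esub>"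

definition sword_inv :: "'a signed_word \<Rightarrow> 'a signed_word" where
  "sword_inv w = rev (map (\<lambda>(s, x). (\<not> s, x)) w)"

lemma swords_simps [simp]:
  "[] \<in> swords G"
  "p # w \<in> swords G \<longleftrightarrow> snd p \<in> carrier G \<and> w \<in> swords G"
  "u @ v \<in> swords G \<longleftrightarrow> u \<in> swords G \<and> v \<in> swords G"
  by (auto simp: swords_def mem_Times_iff)

lemma sword_inv_in: "w \<in> swords G \<Longrightarrow> sword_inv w \<in> swords G"
  by (induction w) (auto simp: sword_inv_def)

lemma restrict_hom:
  assumes "group A" "\<phi> \<in> hom A B" shows "restrict \<phi> (carrier A) \<in> hom A B"
proof -
  interpret A: group A by (rule assms)
  show ?thesis using assms(2) by (auto simp: hom_def)
qed

context
  fixes G :: "'a monoid"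
  assumes G: "group G"
begin

interpretation G: group G by (rule G)

lemma sword_dev_in: "a \<in> carrier G \<Longrightarrow> b \<in> carrier G \<Longrightarrow> sword_dev G a b \<in> swords G"
  by (simp add: sword_dev_def)

lemma qcong_swords:
  assumes "qcong G u v" shows "u \<in> swords G \<and> v \<in> swords G"
  using assms
proof induction
qed (simp_all add: sword_dev_in)

lemma qclass_eq_iff:
  assumes "u \<in> swords G" shows "qclass G u = qclass G v \<longleftrightarrow> qcong G u v"
proof
  assume "qclass G u = qclass G v"
  moreover have "u \<in> qclass G u" using assms by (simp add: qclass_def qcong.refl)
  ultimately show "qcong G u v" by (auto simp: qclass_def intro: qcong.sym)
next
  assume "qcong G u v"
  then show "qclass G u = qclass G v"
    unfolding qclass_def using qcong.sym[of G u v] qcong.trans[of G u v] qcong.trans[of G v u]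
    by blast
qed

lemma presented_mult:
  assumes "u \<in> swords G" "v \<in> swords G"
  shows "qclass G u \<otimes>\<^bsub>presented_Q G\<^esub> qclass G v = qclass G (u @ v)"
proof -
  have "qcong G u u" "qcong G v v" using assms by (auto intro: qcong.refl)
  then show ?thesis
    unfolding presented_Q_def qclass_def
    using qcong.trans[of G "u @ v"] qcong.app[of G u _ v] by auto
qed

lemma qcong_inv: "w \<in> swords G \<Longrightarrow> qcong G (sword_inv w @ w) []"
proof (induction w)
  case Nil
  then show ?case by (simp add: sword_inv_def qcong.refl)
next
  case (Cons p w)
  obtain s x where p: "p = (s, x)" by (cases p)
  have x: "x \<in> carrier G" and w: "w \<in> swords G" using Cons.prems p by auto
  have "qcong G ([(\<not> s, x), (s, x)]) []" using qcong.cancel[OF x, of "\<not> s"] by simp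
  then have "qcong G ([(\<not> s, x), (s, x)] @ w) ([] @ w)"
    by (rule qcong.app) (rule qcong.refl[OF w])
  then have "qcong G (sword_inv w @ ([(\<not> s, x), (s, x)] @ w)) (sword_inv w @ ([] @ w))"
    by (rule qcong.app[OF qcong.refl[OF sword_inv_in[OF w]]])
  then have "qcong G (sword_inv w @ [(\<not> s, x), (s, x)] @ w) []"
    using Cons.IH[OF w] qcong.trans by fastforce
  then show ?case by (simp add: sword_inv_def p)
qed

lemma presented_carrier: "carrier (presented_Q G) = qclass G ` swords G"
  and presented_one: "\<one>\<^bsub>presented_Q G\<^esub> = qclass G []"
  by (simp_all add: presented_Q_def)

lemma presented_group: "group (presented_Q G)"
proof (rule groupI)
  fix A assume "A \<in> carrier (presented_Q G)"
  then obtain u where u: "u \<in> swords G" "A = qclass G u" by (auto simp: presented_carrier)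
  then have "qclass G (sword_inv u) \<otimes>\<^bsub>presented_Q G\<^esub> A = \<one>\<^bsub>presented_Q G\<^esub>"
    by (simp add: presented_mult sword_inv_in presented_one qclass_eq_iff qcong_inv)
  then show "\<exists>B\<in>carrier (presented_Q G). B \<otimes>\<^bsub>presented_Q G\<^esub> A = \<one>\<^bsub>presented_Q G\<^esub>"
    using u sword_inv_in by (auto simp: presented_carrier)
qed (auto simp: presented_carrier presented_one presented_mult)

interpretation P: group "presented_Q G" by (rule presented_group)

lemma presented_q_closed: "x \<in> carrier G \<Longrightarrow> presented_q G x \<in> carrier (presented_Q G)"
  by (simp add: presented_q_def presented_carrier)

lemma presented_inv_q:
  "x \<in> carrier G \<Longrightarrow> inv\<^bsub>presented_Q G\<^esub> presented_q G x = qclass G [(False, x)]"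
  using qcong.cancel[of x G False]
  by (intro P.inv_equality)
     (simp_all add: presented_q_def presented_mult presented_one qclass_eq_iff,
      auto simp: presented_carrier)

lemma presented_deviation:
  "a \<in> carrier G \<Longrightarrow> b \<in> carrier G \<Longrightarrow>
   deviation G (presented_Q G) (presented_q G) a b = qclass G (sword_dev G a b)"
  by (simp add: deviation_def presented_inv_q)
     (simp add: presented_q_def presented_mult sword_dev_def)

lemma presented_quadratic: "quadratic_map G (presented_Q G) (presented_q G)"
  unfolding quadratic_map_def
proof (intro conjI ballI)
  show "presented_q G \<in> carrier G \<rightarrow> carrier (presented_Q G)"
    by (auto intro: presented_q_closed)
next
  fix b assume b: "b \<in> carrier G"
  show "(\<lambda>a. deviation G (presented_Q G) (presented_q G) a b) \<in> hom G (presented_Q G)"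
    using b by (intro homI)
      (auto simp: presented_deviation presented_carrier sword_dev_in presented_mult
         qclass_eq_iff intro: qcong.left)
next
  fix a assume a: "a \<in> carrier G"
  show "(\<lambda>b. deviation G (presented_Q G) (presented_q G) a b) \<in> hom G (presented_Q G)"
    using a by (intro homI)
      (auto simp: presented_deviation presented_carrier sword_dev_in presented_mult
         qclass_eq_iff intro: qcong.right)
next
  fix a b c assume "a \<in> carrier G" "b \<in> carrier G" "c \<in> carrier G"
  then show "deviation G (presented_Q G) (presented_q G) a b \<otimes>\<^bsub>presented_Q G\<^esub> presented_q G c =
      presented_q G c \<otimes>\<^bsub>presented_Q G\<^esub> deviation G (presented_Q G) (presented_q G) a b"
    using qcong.comm[of a G b c]
    by (simp add: presented_deviation sword_dev_in presented_q_def presented_mult qclass_eq_iff)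
qed

context
  fixes H :: "'h monoid" and f :: "'a \<Rightarrow> 'h"
  assumes H: "group H" and f: "quadratic_map G H f"
begin

interpretation H: group H by (rule H)

lemma quadratic_closed: "x \<in> carrier G \<Longrightarrow> f x \<in> carrier H"
  using f by (auto simp: quadratic_map_def)

lemma sword_eval_closed: "w \<in> swords G \<Longrightarrow> sword_eval H f w \<in> carrier H"
  by (induction w) (auto simp: sword_eval_def quadratic_closed)

lemma sword_eval_app:
  "u \<in> swords G \<Longrightarrow> v \<in> swords G \<Longrightarrow>
   sword_eval H f (u @ v) = sword_eval H f u \<otimes>\<^bsub>H\<^esub> sword_eval H f v"
proof (induction u)
  case Nil
  then show ?case using sword_eval_closed[of v] by (simp add: sword_eval_def)
next
  case (Cons p u)
  then show ?case using sword_eval_closed[of u] sword_eval_closed[of v]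
    by (cases p) (auto simp: sword_eval_def quadratic_closed H.m_assoc)
qed

lemma sword_eval_dev:
  "a \<in> carrier G \<Longrightarrow> b \<in> carrier G \<Longrightarrow> sword_eval H f (sword_dev G a b) = deviation G H f a b"
  by (simp add: sword_eval_def sword_dev_def deviation_def quadratic_closed H.m_assoc)

lemma sword_eval_cong: "qcong G u v \<Longrightarrow> sword_eval H f u = sword_eval H f v"
proof (induction rule: qcong.induct)
  case (app u v u' v')
  then show ?case using qcong_swords by (metis sword_eval_app)
next
  case (cancel x s)
  then show ?case by (cases s) (simp_all add: sword_eval_def quadratic_closed)
next
  case (left a a' b)
  then have "deviation G H f (a \<otimes>\<^bsub>G\<^esub> a') b = deviation G H f a b \<otimes>\<^bsub>H\<^esub> deviation G H f a' b"
    using f unfolding quadratic_map_def hom_def by auto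
  with left show ?case by (simp add: sword_eval_app sword_eval_dev sword_dev_in)
next
  case (right a b b')
  then have "deviation G H f a (b \<otimes>\<^bsub>G\<^esub> b') = deviation G H f a b \<otimes>\<^bsub>H\<^esub> deviation G H f a b'"
    using f unfolding quadratic_map_def hom_def by auto
  with right show ?case by (simp add: sword_eval_app sword_eval_dev sword_dev_in)
next
  case (comm a b c)
  have c: "sword_eval H f [(True, c)] = f c"
    using comm by (simp add: sword_eval_def quadratic_closed)
  have "deviation G H f a b \<otimes>\<^bsub>H\<^esub> f c = f c \<otimes>\<^bsub>H\<^esub> deviation G H f a b"
    using comm f unfolding quadratic_map_def by auto
  then show ?case using comm c
    sword_eval_app[of "sword_dev G a b" "[(True, c)]"] sword_eval_app[of "[(True, c)]" "sword_dev G a b"]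
    by (simp add: sword_eval_dev sword_dev_in)
qed simp_all

lemma presented_lift_exists:
  "\<exists>\<phi>\<in>hom (presented_Q G) H. \<forall>x\<in>carrier G. \<phi> (presented_q G x) = f x"
proof -
  define \<phi> where "\<phi> A = sword_eval H f (SOME u. u \<in> A)" for A
  have \<phi>: "\<phi> (qclass G u) = sword_eval H f u" if "u \<in> swords G" for u
  proof -
    have "u \<in> qclass G u" using that by (simp add: qclass_def qcong.refl)
    then have "(SOME v. v \<in> qclass G u) \<in> qclass G u" by (rule someI)
    then have "qcong G u (SOME v. v \<in> qclass G u)" by (simp add: qclass_def)
    then show ?thesis unfolding \<phi>_def using sword_eval_cong by metis
  qed
  have "\<phi> \<in> hom (presented_Q G) H"
    by (intro homI) (auto simp: presented_carrier presented_mult \<phi> sword_eval_closed sword_eval_app)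
  moreover have "\<phi> (presented_q G x) = f x" if "x \<in> carrier G" for x
    using that by (simp add: presented_q_def \<phi> sword_eval_def quadratic_closed)
  ultimately show ?thesis by blast
qed

end

lemma presented_hom_eq:
  fixes H :: "'h monoid"
  assumes H: "group H" and \<phi>: "\<phi> \<in> hom (presented_Q G) H" and \<psi>: "\<psi> \<in> hom (presented_Q G) H"
    and eq: "\<And>x. x \<in> carrier G \<Longrightarrow> \<phi> (presented_q G x) = \<psi> (presented_q G x)"
    and A: "A \<in> carrier (presented_Q G)"
  shows "\<phi> A = \<psi> A"
proof -
  interpret p: group_hom "presented_Q G" H \<phi>
    using H \<phi> by (simp add: group_hom_def group_hom_axioms_def presented_group)
  interpret s: group_hom "presented_Q G" H \<psi>
    using H \<psi> by (simp add: group_hom_def group_hom_axioms_def presented_group)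
  have "\<phi> (qclass G u) = \<psi> (qclass G u)" if "u \<in> swords G" for u
    using that
  proof (induction u)
    case Nil
    show ?case using p.hom_one s.hom_one by (simp add: presented_one)
  next
    case (Cons y u)
    obtain t x where y: "y = (t, x)" by (cases y)
    have x: "x \<in> carrier G" and u: "u \<in> swords G" using Cons.prems y by auto
    have *: "qclass G [(t, x)] \<in> carrier (presented_Q G)" "qclass G u \<in> carrier (presented_Q G)"
      using x u by (auto simp: presented_carrier)
    have "\<phi> (qclass G [(t, x)]) = \<psi> (qclass G [(t, x)])"
    proof (cases t)
      case True
      then show ?thesis using eq[OF x] by (simp add: presented_q_def)
    next
      case False
      then show ?thesis
        using eq[OF x] presented_inv_q[OF x] p.hom_inv s.hom_inv presented_q_closed[OF x] by metis
    qed
    moreover have "qclass G (y # u) = qclass G [(t, x)] \<otimes>\<^bsub>presented_Q G\<^esub> qclass G u"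
      using x u y by (simp add: presented_mult)
    ultimately show ?case using Cons.IH[OF u] * by simp
  qed
  then show ?thesis using A by (auto simp: presented_carrier)
qed

lemma quadratic_map_comp_hom:
  fixes QG :: "'q monoid" and H :: "'h monoid"
  assumes Q: "group QG" and H: "group H" and q: "quadratic_map G QG q" and \<phi>: "\<phi> \<in> hom QG H"
  shows "quadratic_map G H (\<phi> \<circ> q)"
proof -
  interpret p: group_hom QG H \<phi>
    using Q H \<phi> by (simp add: group_hom_def group_hom_axioms_def)
  have qc: "\<And>x. x \<in> carrier G \<Longrightarrow> q x \<in> carrier QG" using q by (auto simp: quadratic_map_def)
  have dc: "\<And>a b. a \<in> carrier G \<Longrightarrow> b \<in> carrier G \<Longrightarrow> deviation G QG q a b \<in> carrier QG"
    by (simp add: deviation_def qc)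
  have d: "\<And>a b. a \<in> carrier G \<Longrightarrow> b \<in> carrier G \<Longrightarrow>
      deviation G H (\<phi> \<circ> q) a b = \<phi> (deviation G QG q a b)"
    by (simp add: deviation_def qc)
  show ?thesis
    unfolding quadratic_map_def
  proof (intro conjI ballI)
    show "\<phi> \<circ> q \<in> carrier G \<rightarrow> carrier H" using qc by auto
  next
    fix b assume b: "b \<in> carrier G"
    then have h: "(\<lambda>a. deviation G QG q a b) \<in> hom G QG" using q by (simp add: quadratic_map_def)
    show "(\<lambda>a. deviation G H (\<phi> \<circ> q) a b) \<in> hom G H"
      using b hom_mult[OF h] by (intro homI) (simp_all add: d dc)
  next
    fix a assume a: "a \<in> carrier G"
    then have h: "(\<lambda>b. deviation G QG q a b) \<in> hom G QG" using q by (simp add: quadratic_map_def)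
    show "(\<lambda>b. deviation G H (\<phi> \<circ> q) a b) \<in> hom G H"
      using a hom_mult[OF h] by (intro homI) (simp_all add: d dc)
  next
    fix a b c assume abc: "a \<in> carrier G" "b \<in> carrier G" "c \<in> carrier G"
    then have "deviation G QG q a b \<otimes>\<^bsub>QG\<^esub> q c = q c \<otimes>\<^bsub>QG\<^esub> deviation G QG q a b"
      using q by (simp add: quadratic_map_def)
    then have "\<phi> (deviation G QG q a b \<otimes>\<^bsub>QG\<^esub> q c) = \<phi> (q c \<otimes>\<^bsub>QG\<^esub> deviation G QG q a b)"
      by simp
    then show "deviation G H (\<phi> \<circ> q) a b \<otimes>\<^bsub>H\<^esub> (\<phi> \<circ> q) c =
        (\<phi> \<circ> q) c \<otimes>\<^bsub>H\<^esub> deviation G H (\<phi> \<circ> q) a b"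
      using abc by (simp add: d dc qc)
  qed
qed

lemma presented_universal:
  "quadratic_universal_for TYPE('h) G (presented_Q G) (presented_q G)"
  unfolding quadratic_universal_for_def
proof (intro allI impI, elim conjE)
  fix H :: "'h monoid" and f assume H: "group H" and f: "quadratic_map G H f"
  obtain \<phi> where \<phi>: "\<phi> \<in> hom (presented_Q G) H" "\<forall>x\<in>carrier G. \<phi> (presented_q G x) = f x"
    using presented_lift_exists[OF H f] by blast
  let ?r = "restrict \<phi> (carrier (presented_Q G))"
  show "\<exists>!\<phi>. \<phi> \<in> hom (presented_Q G) H \<and> \<phi> \<in> extensional (carrier (presented_Q G)) \<and>
      (\<forall>x\<in>carrier G. \<phi> (presented_q G x) = f x)"
  proof (rule ex1I[of _ ?r])
    show "?r \<in> hom (presented_Q G) H \<and> ?r \<in> extensional (carrier (presented_Q G)) \<and>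
      (\<forall>x\<in>carrier G. ?r (presented_q G x) = f x)"
      using \<phi>(2) restrict_hom[OF presented_group \<phi>(1)] presented_q_closed by simp
  next
    fix \<psi> assume \<psi>: "\<psi> \<in> hom (presented_Q G) H \<and> \<psi> \<in> extensional (carrier (presented_Q G)) \<and>
      (\<forall>x\<in>carrier G. \<psi> (presented_q G x) = f x)"
    have "\<psi> A = \<phi> A" if "A \<in> carrier (presented_Q G)" for A
      by (rule presented_hom_eq[OF H _ \<phi>(1) _ that]) (use \<psi> \<phi>(2) in simp_all)
    then show "\<psi> = ?r" using \<psi> by (auto intro!: extensionalityI[of \<psi> "carrier (presented_Q G)"])
  qed
qed

theorem universal_quadratic_map_exists:
  "universal_quadratic_map G (presented_Q G) (presented_q G)"
  by (simp add: universal_quadratic_map_def presented_group presented_quadratic presented_universal)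

theorem universal_quadratic_map_all_types:
  fixes QG :: "'q monoid"
  assumes U: "universal_quadratic_map G QG q"
  shows "quadratic_universal_for TYPE('h) G QG q"
  unfolding quadratic_universal_for_def
proof (intro allI impI, elim conjE)
  have QG: "group QG" and q: "quadratic_map G QG q"
    and U1: "quadratic_universal_for TYPE('q) G QG q"
    and U2: "quadratic_universal_for TYPE('a signed_word set) G QG q"
    using U by (auto simp: universal_quadratic_map_def)
  have qc: "\<And>x. x \<in> carrier G \<Longrightarrow> q x \<in> carrier QG" using q by (auto simp: quadratic_map_def)
  interpret Q: group QG by (rule QG)
  obtain s where s: "s \<in> hom QG (presented_Q G)" "\<forall>x\<in>carrier G. s (q x) = presented_q G x"
    using ex1_implies_ex[OF quadratic_universal_forD[OF U2 presented_group presented_quadratic]]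
    by (elim exE conjE)
  obtain t where t: "t \<in> hom (presented_Q G) QG" "\<forall>x\<in>carrier G. t (presented_q G x) = q x"
    using presented_lift_exists[OF QG q] by blast
  have ts: "t (s y) = y" if y: "y \<in> carrier QG" for y
  proof -
    let ?C = "carrier QG"
    have h1: "restrict (t \<circ> s) ?C \<in> hom QG QG" using restrict_hom[OF QG hom_compose[OF s(1) t(1)]] .
    have h2: "restrict (\<lambda>x. x) ?C \<in> hom QG QG" by (simp add: hom_def)
    have e1: "\<forall>x\<in>carrier G. restrict (t \<circ> s) ?C (q x) = q x" using s t qc by simp
    have e2: "\<forall>x\<in>carrier G. restrict (\<lambda>x. x) ?C (q x) = q x" using qc by simp
    have ex: "\<exists>!\<phi>. \<phi> \<in> hom QG QG \<and> \<phi> \<in> extensional ?C \<and> (\<forall>x\<in>carrier G. \<phi> (q x) = q x)"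
      by (rule quadratic_universal_forD[OF U1 QG q])
    have "restrict (t \<circ> s) ?C = restrict (\<lambda>x. x) ?C"
      by (rule Uniq_D[OF ex[unfolded ex1_iff_ex_Uniq, THEN conjunct2]]) (intro conjI h1 h2 e1 e2 restrict_extensional)+
    from fun_cong[OF this, of y] y show ?thesis by simp
  qed
  fix H :: "'h monoid" and f assume H: "group H" and f: "quadratic_map G H f"
  obtain \<phi> where \<phi>: "\<phi> \<in> hom (presented_Q G) H" "\<forall>x\<in>carrier G. \<phi> (presented_q G x) = f x"
    using presented_lift_exists[OF H f] by blast
  let ?r = "restrict (\<phi> \<circ> s) (carrier QG)"
  show "\<exists>!\<phi>. \<phi> \<in> hom QG H \<and> \<phi> \<in> extensional (carrier QG) \<and> (\<forall>x\<in>carrier G. \<phi> (q x) = f x)"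
  proof (rule ex1I[of _ ?r])
    show "?r \<in> hom QG H \<and> ?r \<in> extensional (carrier QG) \<and> (\<forall>x\<in>carrier G. ?r (q x) = f x)"
      using restrict_hom[OF QG hom_compose[OF s(1) \<phi>(1)]] s \<phi> qc by simp
  next
    fix \<psi> assume \<psi>: "\<psi> \<in> hom QG H \<and> \<psi> \<in> extensional (carrier QG) \<and> (\<forall>x\<in>carrier G. \<psi> (q x) = f x)"
    have "\<psi> y = \<phi> (s y)" if y: "y \<in> carrier QG" for y
    proof -
      have sy: "s y \<in> carrier (presented_Q G)" using s(1) y by (auto simp: hom_def)
      have "(\<psi> \<circ> t) (s y) = \<phi> (s y)"
        by (rule presented_hom_eq[OF H hom_compose[OF t(1)] \<phi>(1) _ sy])
          (use \<psi> \<phi>(2) t(2) in simp_all)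
      then show ?thesis using ts[OF y] by simp
    qed
    then show "\<psi> = ?r" using \<psi> by (auto intro!: extensionalityI[of \<psi> "carrier QG"])
  qed
qed

lemma quadratic_lift:
  fixes H :: "'h monoid"
  assumes "universal_quadratic_map G QG q" "group H" "quadratic_map G H f"
  shows "quadratic_lift G QG q H f \<in> hom QG H"
    and "\<And>x. x \<in> carrier G \<Longrightarrow> quadratic_lift G QG q H f (q x) = f x"
proof -
  have "\<exists>!\<phi>. \<phi> \<in> hom QG H \<and> \<phi> \<in> extensional (carrier QG) \<and> (\<forall>x\<in>carrier G. \<phi> (q x) = f x)"
    by (rule quadratic_universal_forD[OF universal_quadratic_map_all_types[OF assms(1)] assms(2,3)])
  from theI'[OF this]
  show "quadratic_lift G QG q H f \<in> hom QG H"
    and "\<And>x. x \<in> carrier G \<Longrightarrow> quadratic_lift G QG q H f (q x) = f x"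
    unfolding quadratic_lift_def by blast+
qed

end

end

(* A quadratic map f is multiplicative on the derived subgroup G', because each d_f(-, b) is a
   homomorphism with commuting values. Modulo the values of d_f, which commute with f(G), it preserves
   commutators, and exactly so when one entry lies in G'. Hence f(gamma_3 G) = 1 as soon as
   commutators in H are central; applied to H / gamma_3 H this gives f(gamma_3 G) in gamma_3 H.
   Since the identity of G is quadratic, q is injective. Finally q(gamma_3 G) is normal in Q(G), which q(G)
   generates, so x |-> q(x) mod q(gamma_3 G) descends to a quadratic map on G / gamma_3 G. Its lift
   Q(G / gamma_3 G) -> Q(G) / q(gamma_3 G), composed with Q(pi), is the projection, and this bounds the
   kernel of Q(pi). *)

theory Submission
  imports Defs
begin

section \<open>Commutators and the third term of the lower central series\<close>

text \<open>Condition "commutes with all values of f" is packaged as membership in a subgroup, so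
  that it passes to products and inverses through the closure rules.\<close>

definition centralizer :: "('a, 'm) monoid_scheme \<Rightarrow> 'a set \<Rightarrow> 'a set" where
  "centralizer G S = {z \<in> carrier G. \<forall>s\<in>S. z \<otimes>\<^bsub>G\<^esub> s = s \<otimes>\<^bsub>G\<^esub> z}"

lemma centralizer_closed: "z \<in> centralizer G S \<Longrightarrow> z \<in> carrier G"
  by (simp add: centralizer_def)

lemma centralizerD: "z \<in> centralizer G S \<Longrightarrow> s \<in> S \<Longrightarrow> z \<otimes>\<^bsub>G\<^esub> s = s \<otimes>\<^bsub>G\<^esub> z"
  by (simp add: centralizer_def)

text \<open>Exchanging the roles of the two commuting elements puts \<open>s\<close> into the
  subgroup of all elements commuting with \<open>z\<close>; words in several such \<open>s\<close>
  then lie there too.\<close>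

lemma in_centralizer_singleton:
  "z \<in> centralizer G S \<Longrightarrow> s \<in> S \<Longrightarrow> s \<in> carrier G \<Longrightarrow> s \<in> centralizer G {z}"
  using centralizerD[of z G S s] by (simp add: centralizer_def)

context group
begin

lemma commutator_closed: "a \<in> carrier G \<Longrightarrow> b \<in> carrier G \<Longrightarrow> commutator G a b \<in> carrier G"
  by (simp add: commutator_def)

text \<open>This inverse-free form is the one to which a quadratic map can be applied, since such a
  map need not preserve inverses.\<close>

lemma commutator_eq_iff:
  assumes "a \<in> carrier G" "b \<in> carrier G" "z \<in> carrier G"
  shows "commutator G a b = z \<longleftrightarrow> a \<otimes> b = z \<otimes> (b \<otimes> a)"
proof -
  have "commutator G a b = a \<otimes> b \<otimes> inv (b \<otimes> a)"
    using assms by (simp add: commutator_def inv_mult_group m_assoc)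
  then show ?thesis using assms inv_solve_right[of z "a \<otimes> b" "b \<otimes> a"] by auto
qed

lemma commutator_eq_one_iff:
  "a \<in> carrier G \<Longrightarrow> b \<in> carrier G \<Longrightarrow> commutator G a b = \<one> \<longleftrightarrow> a \<otimes> b = b \<otimes> a"
  by (simp add: commutator_eq_iff)

lemma commutator_in_derived:
  "a \<in> carrier G \<Longrightarrow> b \<in> carrier G \<Longrightarrow> commutator G a b \<in> derived G (carrier G)"
  unfolding derived_def commutator_def by (intro generate.incl) auto

lemma commutator_in_gamma3:
  "a \<in> carrier G \<Longrightarrow> b \<in> derived G (carrier G) \<Longrightarrow> commutator G a b \<in> gamma3 G"
  unfolding gamma3_def by (intro generate.incl) auto

lemma derived_closed: "b \<in> derived G (carrier G) \<Longrightarrow> b \<in> carrier G"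
  using derived_in_carrier by blast

lemma derived_eq_generate:
  "derived G (carrier G) = generate G {commutator G a b | a b. a \<in> carrier G \<and> b \<in> carrier G}"
  unfolding derived_def commutator_def by (rule arg_cong[where f = "generate G"]) auto

lemma gamma3_subset_derived: "gamma3 G \<subseteq> derived G (carrier G)"
  unfolding gamma3_def
  by (rule generate_subgroup_incl[OF _ derived_is_subgroup])
    (auto intro: commutator_in_derived derived_closed)

lemma conj_commutator:
  assumes "g \<in> carrier G" "a \<in> carrier G" "b \<in> carrier G"
  shows "g \<otimes> commutator G a b \<otimes> inv g = commutator G (g \<otimes> a \<otimes> inv g) (g \<otimes> b \<otimes> inv g)"
proof -
  have *: "inv g \<otimes> (g \<otimes> x) = x" if "x \<in> carrier G" for x
    using that assms(1) by (simp flip: m_assoc)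
  show ?thesis
    using assms by (simp add: commutator_def inv_mult_group m_assoc *)
qed

text \<open>Conjugation carries a generator \<open>[a, b]\<close> to the commutator of the
  conjugates, and the conjugate of \<open>b\<close> stays in the normal subgroup
  \<open>derived G (carrier G)\<close>; so the generating set is already stable.\<close>

lemma gamma3_normal: "gamma3 G \<lhd> G"
  unfolding gamma3_def
proof (rule normal_generateI)
  fix h g assume "h \<in> {commutator G a b |a b. a \<in> carrier G \<and> b \<in> derived G (carrier G)}"
    and g: "g \<in> carrier G"
  then obtain a b where ab: "a \<in> carrier G" "b \<in> derived G (carrier G)" "h = commutator G a b"
    by blast
  then have "g \<otimes> b \<otimes> inv g \<in> derived G (carrier G)"
    using g normal.inv_op_closed2[OF derived_self_is_normal] by blast
  then show "g \<otimes> h \<otimes> inv g \<in> {commutator G a b |a b. a \<in> carrier G \<and> b \<in> derived G (carrier G)}"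
    using ab g conj_commutator[OF g ab(1) derived_closed[OF ab(2)]] by blast
qed (auto intro: commutator_closed derived_closed)

lemma gamma3_closed: "x \<in> gamma3 G \<Longrightarrow> x \<in> carrier G"
  using gamma3_subset_derived derived_closed by blast

lemma centralizer_subgroup:
  assumes "S \<subseteq> carrier G" shows "subgroup (centralizer G S) G"
proof (rule subgroupI)
  have "\<one> \<in> centralizer G S" using assms by (auto simp: centralizer_def)
  then show "centralizer G S \<noteq> {}" by blast
next
  fix a assume a: "a \<in> centralizer G S"
  have "inv a \<otimes> s = s \<otimes> inv a" if "s \<in> S" for s
  proof -
    have "a \<in> carrier G" "s \<in> carrier G" "a \<otimes> s = s \<otimes> a"
      using a that assms by (auto simp: centralizer_def)
    then show ?thesis by (metis inv_closed inv_solve_left inv_solve_right m_assoc m_closed)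
  qed
  then show "inv a \<in> centralizer G S" using a by (auto simp: centralizer_def)
next
  fix a b assume "a \<in> centralizer G S" "b \<in> centralizer G S"
  then show "a \<otimes> b \<in> centralizer G S"
    using assms by (auto simp: centralizer_def subset_iff) (metis m_assoc)
qed (auto simp: centralizer_def)

lemma gamma3_group_group: "group (G\<lparr>carrier := gamma3 G\<rparr>)"
  using gamma3_normal by (simp add: normal_imp_subgroup subgroup_imp_group)

end

lemma (in normal) coset_one_iff: "x \<in> carrier G \<Longrightarrow> H #> x = H \<longleftrightarrow> x \<in> H"
  using coset_join1[of H x] coset_join2[of x H] subgroup_axioms by auto

text \<open>Lifting to representatives, \<open>[c, [a, b]]\<close> is a generator of
  \<open>gamma3 G\<close>, so it dies in the quotient.\<close>

lemma (in group) commutators_central_mod_gamma3: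
  assumes "A \<in> carrier (G Mod gamma3 G)" "B \<in> carrier (G Mod gamma3 G)"
    "C \<in> carrier (G Mod gamma3 G)"
  shows "commutator (G Mod gamma3 G) A B \<otimes>\<^bsub>G Mod gamma3 G\<^esub> C =
    C \<otimes>\<^bsub>G Mod gamma3 G\<^esub> commutator (G Mod gamma3 G) A B"
proof -
  interpret N: normal "gamma3 G" G by (rule gamma3_normal)
  interpret Q: group "G Mod gamma3 G" by (rule N.factorgroup_is_group)
  let ?p = "\<lambda>x. gamma3 G #> x"
  interpret p: group_hom G "G Mod gamma3 G" ?p
    by unfold_locales (rule N.r_coset_hom_Mod)
  obtain a b c where abc: "a \<in> carrier G" "b \<in> carrier G" "c \<in> carrier G"
    and eq: "A = ?p a" "B = ?p b" "C = ?p c"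
    using assms by (auto simp: carrier_FactGroup)
  have p: "?p (commutator G x y) = commutator (G Mod gamma3 G) (?p x) (?p y)"
    if "x \<in> carrier G" "y \<in> carrier G" for x y
    using that unfolding commutator_def by (simp del: mult_FactGroup)
  have "commutator G c (commutator G a b) \<in> gamma3 G"
    using abc by (intro commutator_in_gamma3 commutator_in_derived)
  then have "?p (commutator G c (commutator G a b)) = \<one>\<^bsub>G Mod gamma3 G\<^esub>"
    using abc by (simp add: N.coset_one_iff commutator_closed)
  then have "commutator (G Mod gamma3 G) C (commutator (G Mod gamma3 G) A B) = \<one>\<^bsub>G Mod gamma3 G\<^esub>"
    using abc by (simp add: p commutator_closed eq)
  then show ?thesis
    using assms Q.commutator_eq_one_iff[of C "commutator (G Mod gamma3 G) A B"] Q.commutator_closed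
    by simp
qed

text \<open>The values commute only with each other and the target may be nonabelian, which is the
  situation of \<open>dev\<close> in one variable. Commutators still land in the kernel.\<close>

lemma hom_commuting_values_derived:
  assumes "group_hom G H h"
    and comm: "\<And>x y. x \<in> carrier G \<Longrightarrow> y \<in> carrier G \<Longrightarrow> h x \<otimes>\<^bsub>H\<^esub> h y = h y \<otimes>\<^bsub>H\<^esub> h x"
    and x: "x \<in> derived G (carrier G)"
  shows "h x = \<one>\<^bsub>H\<^esub>"
proof -
  interpret group_hom G H h by (rule assms(1))
  have "h (commutator G a b) = commutator H (h a) (h b)" if "a \<in> carrier G" "b \<in> carrier G" for a b
    using that by (simp add: commutator_def)
  then have "derived G (carrier G) \<subseteq> kernel G H h"
    unfolding G.derived_eq_generate
    by (intro G.generate_subgroup_incl subgroup_kernel)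
      (auto simp: kernel_def G.commutator_closed H.commutator_eq_one_iff comm)
  then show ?thesis using x by (auto simp: kernel_def)
qed

section \<open>Quadratic maps\<close>

locale quadratic = G: group G + H: group H
  for G :: "('a, 'm) monoid_scheme" and H :: "('b, 'n) monoid_scheme" +
  fixes f :: "'a \<Rightarrow> 'b"
  assumes quadratic: "quadratic_map G H f"
begin

abbreviation dev :: "'a \<Rightarrow> 'a \<Rightarrow> 'b" where "dev \<equiv> deviation G H f"

lemma closed [simp]: "x \<in> carrier G \<Longrightarrow> f x \<in> carrier H"
  using quadratic by (auto simp: quadratic_map_def)

lemma dev_closed [simp]: "a \<in> carrier G \<Longrightarrow> b \<in> carrier G \<Longrightarrow> dev a b \<in> carrier H"
  by (simp add: deviation_def)

section \<open>Deviations and multiplicativity on the derived subgroup\<close>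

lemma f_mult:
  "a \<in> carrier G \<Longrightarrow> b \<in> carrier G \<Longrightarrow> f (a \<otimes>\<^bsub>G\<^esub> b) = dev a b \<otimes>\<^bsub>H\<^esub> (f a \<otimes>\<^bsub>H\<^esub> f b)"
  by (simp add: deviation_def H.m_assoc) (simp flip: H.m_assoc)

lemma dev_hom_left: "b \<in> carrier G \<Longrightarrow> (\<lambda>a. dev a b) \<in> hom G H"
  and dev_hom_right: "a \<in> carrier G \<Longrightarrow> dev a \<in> hom G H"
  using quadratic by (auto simp: quadratic_map_def)

lemma dev_in_centralizer:
  "a \<in> carrier G \<Longrightarrow> b \<in> carrier G \<Longrightarrow> dev a b \<in> centralizer H (f ` carrier G)"
  using quadratic by (auto simp: quadratic_map_def centralizer_def)

lemma centralizer_subgroup: "subgroup (centralizer H (f ` carrier G)) H"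
  by (rule H.centralizer_subgroup) auto

text \<open>A deviation is a word in values of \<open>f\<close> and their inverses, so whatever
  commutes with those values commutes with it. Taking another deviation for \<open>z\<close> shows
  that deviations commute among themselves.\<close>

lemma dev_commute:
  assumes "a \<in> carrier G" "b \<in> carrier G" and z: "z \<in> centralizer H (f ` carrier G)"
  shows "dev a b \<otimes>\<^bsub>H\<^esub> z = z \<otimes>\<^bsub>H\<^esub> dev a b"
proof -
  interpret C: subgroup "centralizer H {z}" H
    using centralizer_closed[OF z] by (intro H.centralizer_subgroup) simp
  have fC: "f x \<in> centralizer H {z}" if "x \<in> carrier G" for x
    using that by (intro in_centralizer_singleton[OF z]) simp_all
  have "dev a b \<in> centralizer H {z}"
    unfolding deviation_def using assms fC by (simp add: C.m_closed C.m_inv_closed)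
  then show ?thesis by (rule centralizerD) simp
qed

lemma dev_derived_left:
  assumes x: "x \<in> derived G (carrier G)" and b: "b \<in> carrier G"
  shows "dev x b = \<one>\<^bsub>H\<^esub>"
proof (rule hom_commuting_values_derived[OF _ _ x])
  show "group_hom G H (\<lambda>a. dev a b)"
    using b by unfold_locales (rule dev_hom_left)
qed (intro dev_commute dev_in_centralizer b)

lemma f_mult_derived:
  "x \<in> derived G (carrier G) \<Longrightarrow> b \<in> carrier G \<Longrightarrow> f (x \<otimes>\<^bsub>G\<^esub> b) = f x \<otimes>\<^bsub>H\<^esub> f b"
  by (simp add: f_mult dev_derived_left G.derived_closed)

text \<open>On the derived subgroup \<open>f\<close> is an honest homomorphism, so facts about
  homomorphisms become available there.\<close>

lemma group_hom_derived: "group_hom (G\<lparr>carrier := derived G (carrier G)\<rparr>) H f"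
  unfolding group_hom_def group_hom_axioms_def
  by (auto simp: hom_def f_mult_derived G.derived_closed
      intro: G.subgroup_imp_group G.derived_is_subgroup)

lemma hom_gamma3: "f \<in> hom (G\<lparr>carrier := gamma3 G\<rparr>) H"
proof (rule homI)
  fix x y assume "x \<in> carrier (G\<lparr>carrier := gamma3 G\<rparr>)" "y \<in> carrier (G\<lparr>carrier := gamma3 G\<rparr>)"
  then have "x \<in> derived G (carrier G)" "y \<in> carrier G"
    using G.gamma3_subset_derived G.gamma3_closed by auto
  then show "f (x \<otimes>\<^bsub>G\<lparr>carrier := gamma3 G\<rparr>\<^esub> y) = f x \<otimes>\<^bsub>H\<^esub> f y"
    by (simp add: f_mult_derived)
qed (simp add: G.gamma3_closed)

section \<open>Values at the identity and on commutators\<close>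

lemma f_one [simp]: "f \<one>\<^bsub>G\<^esub> = \<one>\<^bsub>H\<^esub>"
  using group_hom.hom_one[OF group_hom_derived] by simp

text \<open>Apply \<open>f\<close> to \<open>a b = [a, b] (b a)\<close>: the factor
  \<open>[a, b]\<close> lies in the derived subgroup, so \<open>f\<close> splits it off, and
  comparing with \<open>f_mult\<close> for \<open>a b\<close> and for \<open>b a\<close> leaves a
  correction by two deviations.\<close>

lemma f_commutator:
  assumes a: "a \<in> carrier G" and b: "b \<in> carrier G"
  shows "f (commutator G a b) =
    commutator H (f a) (f b) \<otimes>\<^bsub>H\<^esub> (dev a b \<otimes>\<^bsub>H\<^esub> inv\<^bsub>H\<^esub> dev b a)"
proof -
  interpret C: subgroup "centralizer H (f ` carrier G)" H by (rule centralizer_subgroup)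
  define z where "z = dev a b \<otimes>\<^bsub>H\<^esub> inv\<^bsub>H\<^esub> dev b a"
  define c where "c = commutator H (f a) (f b)"
  have z: "z \<in> centralizer H (f ` carrier G)"
    unfolding z_def using a b by (simp add: dev_in_centralizer C.m_closed C.m_inv_closed)
  then have zc: "z \<in> carrier H" by simp
  have c: "c \<in> carrier H" unfolding c_def using a b by (simp add: H.commutator_closed)
  let ?x = "commutator G a b" and ?ba = "f b \<otimes>\<^bsub>H\<^esub> f a"
  have x: "?x \<in> derived G (carrier G)" using a b by (rule G.commutator_in_derived)
  then have xc: "f ?x \<in> carrier H" by (simp add: G.derived_closed)
  have "f ?x \<otimes>\<^bsub>H\<^esub> (dev b a \<otimes>\<^bsub>H\<^esub> ?ba) = f (?x \<otimes>\<^bsub>G\<^esub> (b \<otimes>\<^bsub>G\<^esub> a))"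
    using a b x by (simp add: f_mult_derived f_mult)
  also have "?x \<otimes>\<^bsub>G\<^esub> (b \<otimes>\<^bsub>G\<^esub> a) = a \<otimes>\<^bsub>G\<^esub> b"
    using a b G.commutator_eq_iff[of a b ?x] by (simp add: G.commutator_closed)
  also have "f (a \<otimes>\<^bsub>G\<^esub> b) = dev a b \<otimes>\<^bsub>H\<^esub> (f a \<otimes>\<^bsub>H\<^esub> f b)" using a b by (rule f_mult)
  also have "f a \<otimes>\<^bsub>H\<^esub> f b = c \<otimes>\<^bsub>H\<^esub> ?ba"
    using a b c H.commutator_eq_iff[of "f a" "f b" c] by (simp add: c_def)
  also have "dev a b = z \<otimes>\<^bsub>H\<^esub> dev b a" using a b by (simp add: z_def H.m_assoc)
  also have "(z \<otimes>\<^bsub>H\<^esub> dev b a) \<otimes>\<^bsub>H\<^esub> (c \<otimes>\<^bsub>H\<^esub> ?ba) = (c \<otimes>\<^bsub>H\<^esub> z) \<otimes>\<^bsub>H\<^esub> (dev b a \<otimes>\<^bsub>H\<^esub> ?ba)"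
  proof -
    \<comment> \<open>\<open>c\<close> is a word in \<open>f a\<close>, \<open>f b\<close> and their
      inverses, so everything that commutes with the values of \<open>f\<close> commutes with
      \<open>c\<close>.\<close>
    have cK: "u \<otimes>\<^bsub>H\<^esub> c = c \<otimes>\<^bsub>H\<^esub> u" if u: "u \<in> centralizer H (f ` carrier G)" for u
    proof -
      interpret U: subgroup "centralizer H {u}" H
        using centralizer_closed[OF u] by (intro H.centralizer_subgroup) simp
      have "f a \<in> centralizer H {u}" "f b \<in> centralizer H {u}"
        using a b by (auto intro: in_centralizer_singleton[OF u])
      then have "c \<in> centralizer H {u}"
        unfolding c_def commutator_def by (simp add: U.m_closed U.m_inv_closed)
      then show ?thesis using centralizerD by fastforce
    qed
    \<comment> \<open>The product is moved past \<open>c\<close> in one go; both of its factors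
      centralize the values of \<open>f\<close>.\<close>
    have "z \<otimes>\<^bsub>H\<^esub> dev b a \<in> centralizer H (f ` carrier G)"
      using z a b by (simp add: dev_in_centralizer C.m_closed)
    from cK[OF this] show ?thesis
      using a b c zc by (simp add: H.m_assoc) (simp flip: H.m_assoc)
  qed
  finally have "f ?x = c \<otimes>\<^bsub>H\<^esub> z"
    using a b c zc xc by simp
  then show ?thesis by (simp add: c_def z_def)
qed

text \<open>With \<open>b\<close> in the derived subgroup, \<open>dev a b\<close> and
  \<open>dev b a\<close> are both trivial, so the correction in \<open>f_commutator\<close>
  disappears.\<close>

lemma f_commutator_derived:
  assumes a: "a \<in> carrier G" and b: "b \<in> derived G (carrier G)"
  shows "f (commutator G a b) = commutator H (f a) (f b)"
proof -
  have bc: "b \<in> carrier G" using b by (rule G.derived_closed)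
  have "dev a b = \<one>\<^bsub>H\<^esub>"
  proof (rule hom_commuting_values_derived[OF _ _ b])
    show "group_hom G H (dev a)"
      using a by unfold_locales (rule dev_hom_right)
  qed (intro dev_commute dev_in_centralizer a)
  then show ?thesis
    using a b bc by (simp add: f_commutator dev_derived_left H.commutator_closed)
qed

text \<open>The conjugate equals \<open>[x, n] n\<close> with \<open>[x, n]\<close> in the derived
  subgroup, which avoids evaluating \<open>f\<close> at the inverse of \<open>x\<close>.\<close>

lemma f_conj_derived:
  assumes x: "x \<in> carrier G" and n: "n \<in> derived G (carrier G)"
  shows "f (x \<otimes>\<^bsub>G\<^esub> n \<otimes>\<^bsub>G\<^esub> inv\<^bsub>G\<^esub> x) = f x \<otimes>\<^bsub>H\<^esub> f n \<otimes>\<^bsub>H\<^esub> inv\<^bsub>H\<^esub> f x"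
proof -
  have nc: "n \<in> carrier G" using n by (rule G.derived_closed)
  have "x \<otimes>\<^bsub>G\<^esub> n \<otimes>\<^bsub>G\<^esub> inv\<^bsub>G\<^esub> x = commutator G x n \<otimes>\<^bsub>G\<^esub> n"
    using x nc by (simp add: commutator_def G.m_assoc)
  then have "f (x \<otimes>\<^bsub>G\<^esub> n \<otimes>\<^bsub>G\<^esub> inv\<^bsub>G\<^esub> x) = commutator H (f x) (f n) \<otimes>\<^bsub>H\<^esub> f n"
    using x n nc by (simp add: f_mult_derived f_commutator_derived G.commutator_in_derived)
  also have "\<dots> = f x \<otimes>\<^bsub>H\<^esub> f n \<otimes>\<^bsub>H\<^esub> inv\<^bsub>H\<^esub> f x"
    using x nc by (simp add: commutator_def H.m_assoc)
  finally show ?thesis .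
qed

section \<open>Images of generated and of normal subgroups\<close>

lemma image_generate_derived:
  assumes "S \<subseteq> derived G (carrier G)"
  shows "f ` generate G S = generate H (f ` S)"
  \<comment> \<open>\<open>f\<close> is a homomorphism only on the derived subgroup, so the subgroup
    generated by \<open>S\<close> is computed inside it, where it is the same set as in
    \<open>G\<close>.\<close>
  using group_hom.generate_img[OF group_hom_derived, of S] assms
    G.generate_consistent[OF assms G.derived_is_subgroup] by simp

text \<open>First, \<open>f\<close> maps the derived subgroup into the centralizer of its own
  values. Then \<open>f [a, b] = [f a, f b]\<close> is trivial whenever \<open>b\<close> is in the
  derived subgroup.\<close>

lemma image_gamma3_trivial:
  assumes central: "\<And>x y z. x \<in> carrier H \<Longrightarrow> y \<in> carrier H \<Longrightarrow> z \<in> carrier H \<Longrightarrow>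
      commutator H x y \<otimes>\<^bsub>H\<^esub> z = z \<otimes>\<^bsub>H\<^esub> commutator H x y"
    and x: "x \<in> gamma3 G"
  shows "f x = \<one>\<^bsub>H\<^esub>"
proof -
  interpret C: subgroup "centralizer H (f ` carrier G)" H by (rule centralizer_subgroup)
  have "f (commutator G a b) \<in> centralizer H (f ` carrier G)"
    if "a \<in> carrier G" "b \<in> carrier G" for a b
  proof -
    have "commutator H (f a) (f b) \<in> centralizer H (f ` carrier G)"
      unfolding centralizer_def
      using that by (auto simp: H.commutator_closed intro!: central)
    then show ?thesis
      using that by (simp add: f_commutator dev_in_centralizer C.m_closed C.m_inv_closed)
  qed
  \<comment> \<open>Commutators in \<open>H\<close> are central and deviations centralize the values
    of \<open>f\<close>, so this holds on generators by \<open>f_commutator\<close>.\<close>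
  then have *: "f ` derived G (carrier G) \<subseteq> centralizer H (f ` carrier G)"
    unfolding G.derived_eq_generate
    by (subst image_generate_derived)
      (auto intro: G.commutator_in_derived intro!: H.generate_subgroup_incl[OF _ centralizer_subgroup])
  have "f (commutator G a b) = \<one>\<^bsub>H\<^esub>"
    if "a \<in> carrier G" "b \<in> derived G (carrier G)" for a b
  proof -
    have "f b \<in> centralizer H (f ` carrier G)" using * that by blast
    then have "f b \<otimes>\<^bsub>H\<^esub> f a = f a \<otimes>\<^bsub>H\<^esub> f b" using that by (auto intro: centralizerD[of "f b"])
    then show ?thesis
      using that by (simp add: f_commutator_derived H.commutator_eq_one_iff G.derived_closed)
  qed
  then have "f ` gamma3 G \<subseteq> {\<one>\<^bsub>H\<^esub>}"
    unfolding gamma3_def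
    by (subst image_generate_derived)
      (auto intro: G.commutator_in_derived G.derived_closed
        intro!: H.generate_subgroup_incl[OF _ H.triv_subgroup])
  then show ?thesis using x by auto
qed

lemma image_normal:
  assumes "N \<lhd> G" and sub: "N \<subseteq> derived G (carrier G)"
    and gen: "generate H (f ` carrier G) = carrier H"
  shows "f ` N \<lhd> H"
proof -
  interpret N: normal N G by (rule assms)
  have "subgroup N (G\<lparr>carrier := derived G (carrier G)\<rparr>)"
    using sub by (intro G.subgroup_incl N.subgroup_axioms G.derived_is_subgroup) simp_all
  then have fN: "subgroup (f ` N) H"
    by (rule group_hom.subgroup_img_is_subgroup[OF group_hom_derived])
  have conj: "f (x \<otimes>\<^bsub>G\<^esub> n \<otimes>\<^bsub>G\<^esub> inv\<^bsub>G\<^esub> x) = f x \<otimes>\<^bsub>H\<^esub> f n \<otimes>\<^bsub>H\<^esub> inv\<^bsub>H\<^esub> f x"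
    if "x \<in> carrier G" "n \<in> N" for x n
    using that sub by (intro f_conj_derived) auto
  show ?thesis
    unfolding H.normal_inv_iff
  proof (intro conjI fN ballI)
    fix y u assume "y \<in> carrier H" and u: "u \<in> f ` N"
    then have "y \<in> generate H (f ` carrier G)" by (simp add: gen)
    then show "y \<otimes>\<^bsub>H\<^esub> u \<otimes>\<^bsub>H\<^esub> inv\<^bsub>H\<^esub> y \<in> f ` N"
      using u
    proof (induction arbitrary: u)
      case one
      then show ?case using subgroup.mem_carrier[OF fN] by simp
    next
      case (incl h)
      then obtain x n where x: "x \<in> carrier G" "h = f x" and n: "n \<in> N" "u = f n" by auto
      then show ?case using conj[of x n] N.inv_op_closed2[of x n] by (metis imageI)
    next
      case (inv h)
      then obtain x n where x: "x \<in> carrier G" "h = f x" and n: "n \<in> N" "u = f n" by auto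
      \<comment> \<open>Since \<open>f\<close> of an inverse need not be the inverse of
        \<open>f x\<close>, the conjugation formula is used at \<open>m\<close> with
        \<open>n = x m x^-1\<close> and then solved for \<open>f m\<close>.\<close>
      define m where "m = inv\<^bsub>G\<^esub> x \<otimes>\<^bsub>G\<^esub> n \<otimes>\<^bsub>G\<^esub> x"
      have m: "m \<in> N" unfolding m_def using x n by (simp add: N.inv_op_closed1)
      have "n = x \<otimes>\<^bsub>G\<^esub> m \<otimes>\<^bsub>G\<^esub> inv\<^bsub>G\<^esub> x"
        unfolding m_def using x n by (simp add: G.m_assoc) (simp flip: G.m_assoc)
      then have "f n = f x \<otimes>\<^bsub>H\<^esub> f m \<otimes>\<^bsub>H\<^esub> inv\<^bsub>H\<^esub> f x" using conj[OF x(1) m] by simp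
      then have "inv\<^bsub>H\<^esub> f x \<otimes>\<^bsub>H\<^esub> f n \<otimes>\<^bsub>H\<^esub> f x = f m"
        using x m by (simp add: H.m_assoc) (simp flip: H.m_assoc)
      then show ?case using x n m by simp
    next
      case (eng h1 h2)
      then have "h1 \<in> carrier H" "h2 \<in> carrier H" "u \<in> carrier H"
        using gen subgroup.mem_carrier[OF fN] by auto
      then have "h1 \<otimes>\<^bsub>H\<^esub> h2 \<otimes>\<^bsub>H\<^esub> u \<otimes>\<^bsub>H\<^esub> inv\<^bsub>H\<^esub> (h1 \<otimes>\<^bsub>H\<^esub> h2) =
          h1 \<otimes>\<^bsub>H\<^esub> (h2 \<otimes>\<^bsub>H\<^esub> u \<otimes>\<^bsub>H\<^esub> inv\<^bsub>H\<^esub> h2) \<otimes>\<^bsub>H\<^esub> inv\<^bsub>H\<^esub> h1"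
        by (simp add: H.inv_mult_group H.m_assoc)
      then show ?case using eng by simp
    qed
  qed
qed

end

section \<open>Identity, precomposition and descent to quotients\<close>

lemma (in group) quadratic_map_id: "quadratic_map G G (\<lambda>x. x)"
proof -
  have "deviation G G (\<lambda>x. x) a b = \<one>" if "a \<in> carrier G" "b \<in> carrier G" for a b
    using that by (simp add: deviation_def m_assoc)
  then show ?thesis by (auto simp: quadratic_map_def hom_def)
qed

lemma quadratic_map_hom_comp:
  assumes "group_hom A G h" and "quadratic G H f"
  shows "quadratic_map A H (f \<circ> h)"
proof -
  interpret h: group_hom A G h by (rule assms)
  interpret quadratic G H f by (rule assms)
  have d: "deviation A H (f \<circ> h) a b = dev (h a) (h b)" if "a \<in> carrier A" "b \<in> carrier A" for a b
    using that by (simp add: deviation_def)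
  show ?thesis
    unfolding quadratic_map_def
  proof (intro conjI ballI)
    fix b assume "b \<in> carrier A"
    then show "(\<lambda>a. deviation A H (f \<circ> h) a b) \<in> hom A H"
      using hom_mult[OF dev_hom_left] by (auto simp: d intro!: homI)
  next
    fix a assume "a \<in> carrier A"
    then show "deviation A H (f \<circ> h) a \<in> hom A H"
      using hom_mult[OF dev_hom_right] by (auto simp: d intro!: homI)
  qed (use dev_in_centralizer in \<open>auto simp: d centralizer_def\<close>)
qed

text \<open>For \<open>n\<close> in \<open>N\<close>, which lies in the derived subgroup,
  \<open>f (n x) = f n f x = f x\<close>, so \<open>f\<close> is constant on cosets.\<close>

lemma quadratic_descend:
  fixes G :: "'a monoid" and H :: "'b monoid"
  assumes "quadratic G H f" and "N \<lhd> G" and sub: "N \<subseteq> derived G (carrier G)"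
    and triv: "\<And>n. n \<in> N \<Longrightarrow> f n = \<one>\<^bsub>H\<^esub>"
  obtains g where "quadratic_map (G Mod N) H g"
    and "\<And>x. x \<in> carrier G \<Longrightarrow> g (N #>\<^bsub>G\<^esub> x) = f x"
proof -
  interpret quadratic G H f by (rule assms)
  interpret N: normal N G by (rule assms)
  interpret Q: group "G Mod N" by (rule N.factorgroup_is_group)
  \<comment> \<open>The image of a coset under \<open>f\<close> is a singleton, so no representative
    has to be chosen.\<close>
  define g where "g A = the_elem (f ` A)" for A
  have g: "g (N #>\<^bsub>G\<^esub> x) = f x" if x: "x \<in> carrier G" for x
  proof -
    have "f y = f x" if "y \<in> N #>\<^bsub>G\<^esub> x" for y
      using that x sub triv by (auto simp: r_coset_def f_mult_derived)
    moreover have "x \<in> N #>\<^bsub>G\<^esub> x" using x by (rule G.rcos_self) (rule N.subgroup_axioms)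
    ultimately have "f ` (N #>\<^bsub>G\<^esub> x) = {f x}" by blast
    then show ?thesis by (simp add: g_def)
  qed
  have dg: "deviation (G Mod N) H g (N #>\<^bsub>G\<^esub> a) (N #>\<^bsub>G\<^esub> b) = dev a b"
    if "a \<in> carrier G" "b \<in> carrier G" for a b
    using that by (simp add: deviation_def g N.rcos_sum)
  have "quadratic_map (G Mod N) H g"
    unfolding quadratic_map_def
  proof (intro conjI ballI)
    show "g \<in> carrier (G Mod N) \<rightarrow> carrier H" by (auto simp: carrier_FactGroup g)
  next
    fix B assume "B \<in> carrier (G Mod N)"
    then show "(\<lambda>A. deviation (G Mod N) H g A B) \<in> hom (G Mod N) H"
      using hom_mult[OF dev_hom_left] by (auto simp: carrier_FactGroup dg N.rcos_sum intro!: homI)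
  next
    fix A assume "A \<in> carrier (G Mod N)"
    then show "deviation (G Mod N) H g A \<in> hom (G Mod N) H"
      using hom_mult[OF dev_hom_right] by (auto simp: carrier_FactGroup dg N.rcos_sum intro!: homI)
  next
    fix A B C assume "A \<in> carrier (G Mod N)" "B \<in> carrier (G Mod N)" "C \<in> carrier (G Mod N)"
    then show "deviation (G Mod N) H g A B \<otimes>\<^bsub>H\<^esub> g C = g C \<otimes>\<^bsub>H\<^esub> deviation (G Mod N) H g A B"
      using dev_in_centralizer by (auto simp: carrier_FactGroup dg g centralizer_def)
  qed
  then show ?thesis using g that by blast
qed

section \<open>The universal quadratic map\<close>

lemma universal_quadratic:
  fixes G :: "'a monoid"
  assumes "group G" and "universal_quadratic_map G QG q"
  shows "quadratic G QG q"
  using assms by (simp add: universal_quadratic_map_def quadratic_def quadratic_axioms_def)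

text \<open>Both homomorphisms lift the same quadratic map \<open>\<phi> \<circ> q\<close>; this is
  the tool for checking identities on \<open>QG\<close> only at the elements
  \<open>q x\<close>.\<close>

lemma universal_hom_eq:
  fixes G :: "'a monoid" and H :: "'h monoid"
  assumes G: "group G" and U: "universal_quadratic_map G QG q" and H: "group H"
    and \<phi>: "\<phi> \<in> hom QG H" and \<psi>: "\<psi> \<in> hom QG H"
    and eq: "\<And>x. x \<in> carrier G \<Longrightarrow> \<phi> (q x) = \<psi> (q x)"
    and y: "y \<in> carrier QG"
  shows "\<phi> y = \<psi> y"
proof -
  interpret quadratic G QG q by (rule universal_quadratic[OF G U])
  have "quadratic_map G H (\<phi> \<circ> q)"
    by (rule quadratic_map_comp_hom[OF G H.is_group H quadratic \<phi>])
  then have "\<exists>\<^sub>\<le>\<^sub>1\<chi>. \<chi> \<in> hom QG H \<and> \<chi> \<in> extensional (carrier QG) \<and>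
      (\<forall>x\<in>carrier G. \<chi> (q x) = (\<phi> \<circ> q) x)"
    using quadratic_universal_forD[OF universal_quadratic_map_all_types[OF G U] H]
    unfolding ex1_iff_ex_Uniq by blast
  \<comment> \<open>Uniqueness of lifts holds among extensional functions, hence the passage to
    restrictions.\<close>
  then have "restrict \<phi> (carrier QG) = restrict \<psi> (carrier QG)"
    by (rule Uniq_D) (simp_all add: eq restrict_hom[OF H.is_group] \<phi> \<psi>)
  then show ?thesis using y by (metis restrict_apply')
qed

text \<open>\<open>q\<close> is also quadratic as a map into the subgroup \<open>?K\<close>
  generated by its values. The lift to \<open>?K\<close>, followed by inclusion, fixes every
  \<open>q x\<close> and so is the identity of \<open>QG\<close>; its values lie in
  \<open>?K\<close>.\<close>

lemma universal_generate:
  fixes G :: "'a monoid"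
  assumes G: "group G" and U: "universal_quadratic_map G QG q"
  shows "generate QG (q ` carrier G) = carrier QG"
proof
  interpret quadratic G QG q by (rule universal_quadratic[OF G U])
  let ?K = "generate QG (q ` carrier G)"
  let ?QK = "QG\<lparr>carrier := ?K\<rparr>"
  have K: "subgroup ?K QG" by (rule H.generate_is_subgroup) auto
  then interpret K: subgroup ?K QG .
  show "?K \<subseteq> carrier QG" by (rule K.subset)
  have QK: "group ?QK" by (rule H.subgroup_imp_group[OF K])
  have qK: "q x \<in> ?K" if "x \<in> carrier G" for x using that by (auto intro: generate.incl)
  have d: "deviation G ?QK q a b = dev a b" if "a \<in> carrier G" "b \<in> carrier G" for a b
    using that H.m_inv_consistent[OF K] qK by (simp add: deviation_def)
  have dK: "dev a b \<in> ?K" if "a \<in> carrier G" "b \<in> carrier G" for a b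
    using that qK by (simp add: deviation_def K.m_closed K.m_inv_closed)
  have "quadratic_map G ?QK q"
    unfolding quadratic_map_def
  proof (intro conjI ballI)
    fix b assume "b \<in> carrier G"
    then show "(\<lambda>a. deviation G ?QK q a b) \<in> hom G ?QK"
      using hom_mult[OF dev_hom_left] by (auto simp: d dK intro!: homI)
  next
    fix a assume "a \<in> carrier G"
    then show "deviation G ?QK q a \<in> hom G ?QK"
      using hom_mult[OF dev_hom_right] by (auto simp: d dK intro!: homI)
  qed (use dev_in_centralizer in \<open>auto simp: qK d centralizer_def\<close>)
  note lift = quadratic_lift[OF G U QK this]
  let ?\<phi> = "quadratic_lift G QG q ?QK q"
  have \<phi>: "?\<phi> \<in> hom QG QG" using lift(1) K.subset by (auto simp: hom_def)
  show "carrier QG \<subseteq> ?K"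
  proof
    fix y assume y: "y \<in> carrier QG"
    have "?\<phi> y = y"
      by (rule universal_hom_eq[OF G U H.is_group \<phi> _ _ y]) (auto simp: hom_def lift(2))
    moreover have "?\<phi> y \<in> ?K" using lift(1) y by (auto simp: hom_def)
    ultimately show "y \<in> ?K" by simp
  qed
qed

text \<open>The lift of the identity of \<open>G\<close>, a quadratic map with trivial deviation, is
  a left inverse of \<open>q\<close>.\<close>

lemma universal_inj:
  fixes G :: "'a monoid"
  assumes G: "group G" and U: "universal_quadratic_map G QG q"
  shows "inj_on q (carrier G)"
  using quadratic_lift(2)[OF G U G group.quadratic_map_id[OF G]]
  by (rule inj_on_inverseI)

section \<open>Exactness of the two rows\<close>

lemma gamma3_short_exact:
  fixes G :: "'a monoid"
  assumes "group G"
  shows "short_exact (gamma3_group G) (\<lambda>x. x) G (gamma3_proj G) (gamma3_quotient G)"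
proof -
  interpret G: group G by (rule assms)
  interpret N: normal "gamma3 G" G by (rule G.gamma3_normal)
  have ker: "kernel G (gamma3_quotient G) (gamma3_proj G) = gamma3 G"
    using N.subset N.coset_one_iff by (auto simp: kernel_def gamma3_proj_def)
  show ?thesis
    unfolding short_exact_def ker
    using N.r_coset_hom_Mod N.factorgroup_is_group assms G.gamma3_group_group
    by (auto simp: mon_def epi_def gamma3_proj_def[abs_def] carrier_FactGroup
        hom_def)
qed

text \<open>\<open>Qpi\<close> is taken as any homomorphism with the right values on the elements
  \<open>q x\<close>, which keeps the definite description behind \<open>Q_map\<close> out of the
  argument.\<close>

lemma Q_gamma3_short_exact:
  fixes G :: "'a monoid"
  assumes G: "group G" and U: "universal_quadratic_map G QG q"
    and Ubar: "universal_quadratic_map (gamma3_quotient G) QGbar qbar"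
    and Qpi: "Qpi \<in> hom QG QGbar"
    and Qpi_q: "\<And>x. x \<in> carrier G \<Longrightarrow> Qpi (q x) = qbar (gamma3_proj G x)"
  shows "short_exact (gamma3_group G) q QG Qpi QGbar"
proof -
  interpret q: quadratic G QG q by (rule universal_quadratic[OF G U])
  interpret N: normal "gamma3 G" G by (rule q.G.gamma3_normal)
  have Gbar: "group (gamma3_quotient G)" by (rule N.factorgroup_is_group)
  interpret qbar: quadratic "gamma3_quotient G" QGbar qbar by (rule universal_quadratic[OF Gbar Ubar])
  interpret Qpi: group_hom QG QGbar Qpi by unfold_locales (rule Qpi)
  let ?N = "q ` gamma3 G"
  interpret N': normal ?N QG
    by (rule q.image_normal[OF N.normal_axioms q.G.gamma3_subset_derived universal_generate[OF G U]])
  have Q': "group (QG Mod ?N)" by (rule N'.factorgroup_is_group)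
  have "quadratic G (QG Mod ?N) ((\<lambda>y. ?N #>\<^bsub>QG\<^esub> y) \<circ> q)"
    unfolding quadratic_def quadratic_axioms_def
    using quadratic_map_comp_hom[OF G q.H.is_group Q' q.quadratic N'.r_coset_hom_Mod] G Q' by simp
  then obtain g where g: "quadratic_map (gamma3_quotient G) (QG Mod ?N) g"
    and gq: "\<And>x. x \<in> carrier G \<Longrightarrow> g (gamma3 G #>\<^bsub>G\<^esub> x) = ?N #>\<^bsub>QG\<^esub> q x"
    by (rule quadratic_descend[OF _ N.normal_axioms q.G.gamma3_subset_derived])
      (auto simp: N'.coset_one_iff)
  define r where "r = quadratic_lift (gamma3_quotient G) QGbar qbar (QG Mod ?N) g"
  have r: "r \<in> hom QGbar (QG Mod ?N)"
    and rq: "\<And>A. A \<in> carrier (gamma3_quotient G) \<Longrightarrow> r (qbar A) = g A"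
    unfolding r_def using quadratic_lift[OF Gbar Ubar Q' g] by blast+
  \<comment> \<open>Both sides are homomorphisms on \<open>QG\<close>, and at \<open>q x\<close>
    both give the coset of \<open>q x\<close>. Hence \<open>Qpi y\<close> determines
    \<open>y\<close> modulo \<open>?N\<close>.\<close>
  have proj: "r (Qpi y) = ?N #>\<^bsub>QG\<^esub> y" if y: "y \<in> carrier QG" for y
  proof -
    have "(r \<circ> Qpi) y = ?N #>\<^bsub>QG\<^esub> y"
      by (rule universal_hom_eq[OF G U Q' hom_compose[OF Qpi r] N'.r_coset_hom_Mod _ y])
        (auto simp: Qpi_q gamma3_proj_def rq gq carrier_FactGroup)
    then show ?thesis by simp
  qed
  interpret r: group_hom QGbar "QG Mod ?N" r
    by (simp add: group_hom_def group_hom_axioms_def r Q' qbar.H.is_group)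
  have "kernel QG QGbar Qpi = ?N"
  proof
    show "kernel QG QGbar Qpi \<subseteq> ?N"
    proof
      fix y assume "y \<in> kernel QG QGbar Qpi"
      then have y: "y \<in> carrier QG" "Qpi y = \<one>\<^bsub>QGbar\<^esub>" by (auto simp: kernel_def)
      have "?N #>\<^bsub>QG\<^esub> y = \<one>\<^bsub>QG Mod ?N\<^esub>"
        using proj[OF y(1)] unfolding y(2) r.hom_one by (rule HOL.sym)
      then show "y \<in> ?N" using N'.coset_one_iff[OF y(1)] by simp
    qed
    \<comment> \<open>An element of \<open>gamma3 G\<close> projects to the identity of the
      quotient, and the quadratic map \<open>qbar\<close> preserves the identity.\<close>
    show "?N \<subseteq> kernel QG QGbar Qpi"
      using qbar.f_one by (auto simp: kernel_def Qpi_q gamma3_proj_def N.rcos_const[OF G])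
  qed
  moreover have "Qpi ` carrier QG = carrier QGbar"
  proof
    \<comment> \<open>The range of \<open>Qpi\<close> is a subgroup, so it suffices that it contains
      the values of \<open>qbar\<close>, which generate \<open>QGbar\<close>.\<close>
    have "qbar ` carrier (gamma3_quotient G) \<subseteq> Qpi ` carrier QG"
    proof
      fix z assume "z \<in> qbar ` carrier (gamma3_quotient G)"
      then obtain x where x: "x \<in> carrier G" "z = qbar (gamma3_proj G x)"
        unfolding carrier_FactGroup gamma3_proj_def by blast
      have "Qpi (q x) \<in> Qpi ` carrier QG" using x(1) by (intro imageI q.closed)
      then show "z \<in> Qpi ` carrier QG" by (simp only: x(2) Qpi_q[OF x(1)])
    qed
    then have "generate QGbar (qbar ` carrier (gamma3_quotient G)) \<subseteq> Qpi ` carrier QG"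
      by (rule qbar.H.generate_subgroup_incl) (rule Qpi.img_is_subgroup)
    then show "carrier QGbar \<subseteq> Qpi ` carrier QG"
      by (simp only: universal_generate[OF Gbar Ubar])
  qed (rule Qpi.img_is_subgroup[THEN subgroup.subset])
  moreover have "q \<in> hom (gamma3_group G) QG"
    by (rule q.hom_gamma3)
  moreover have "inj_on q (gamma3 G)"
    using universal_inj[OF G U] by (rule inj_on_subset) (rule N.subset)
  ultimately show ?thesis
    unfolding short_exact_def mon_def epi_def
    using q.G.gamma3_group_group q.H.is_group qbar.H.is_group Qpi by simp
qed

section \<open>The commutative diagram\<close>

theorem mainTheorem4:
  fixes G :: "'a monoid" and H :: "'b monoid" and f :: "'a \<Rightarrow> 'b"
    and QG :: "'q monoid" and q :: "'a \<Rightarrow> 'q"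
    and QGbar :: "'r monoid" and qbar :: "'a set \<Rightarrow> 'r"
  defines "fbar \<equiv> quadratic_lift G QG q H f"
    and "Qpi \<equiv> Q_map G QG q QGbar qbar (gamma3_proj G)"
  assumes "group G" and "group H"
    and "universal_quadratic_map G QG q"
    and "universal_quadratic_map (gamma3_quotient G) QGbar qbar"
    and "quadratic_map G H f"
  shows "fbar \<in> hom QG H \<and> (\<forall>x\<in>carrier G. fbar (q x) = f x) \<and>
    (\<forall>x\<in>carrier G. Qpi (q x) = qbar (gamma3_proj G x)) \<and>
    short_exact (gamma3_group G) q QG Qpi QGbar \<and>
    short_exact (gamma3_group H) (\<lambda>x. x) H (gamma3_proj H) (gamma3_quotient H) \<and>
    (\<exists>f3 fbarbar.
       f3 \<in> hom (gamma3_group G) (gamma3_group H) \<and>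
       fbarbar \<in> hom QGbar (gamma3_quotient H) \<and>
       (\<forall>x\<in>gamma3 G. fbar (q x) = f3 x) \<and>
       (\<forall>y\<in>carrier QG. fbarbar (Qpi y) = gamma3_proj H (fbar y)))"
proof -
  note G = \<open>group G\<close> and H = \<open>group H\<close> and U = assms(5) and Ubar = assms(6) and f = assms(7)
  interpret f: quadratic G H f by (simp add: quadratic_def quadratic_axioms_def G H f)
  interpret N: normal "gamma3 G" G by (rule f.G.gamma3_normal)
  interpret NH: normal "gamma3 H" H by (rule f.H.gamma3_normal)
  have Gbar: "group (gamma3_quotient G)" by (rule N.factorgroup_is_group)
  have Hbar: "group (gamma3_quotient H)" by (rule NH.factorgroup_is_group)
  have proj_closed: "gamma3_proj G x \<in> carrier (gamma3_quotient G)" if "x \<in> carrier G" for x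
    using that by (auto simp: gamma3_proj_def carrier_FactGroup)
  have projH: "gamma3_proj H \<in> hom H (gamma3_quotient H)"
    using NH.r_coset_hom_Mod by (simp add: gamma3_proj_def[abs_def])
  interpret qbar: quadratic "gamma3_quotient G" QGbar qbar by (rule universal_quadratic[OF Gbar Ubar])

  have fbar: "fbar \<in> hom QG H" and fbar_q: "\<And>x. x \<in> carrier G \<Longrightarrow> fbar (q x) = f x"
    unfolding fbar_def using quadratic_lift[OF G U H f] by blast+

  have "group_hom G (gamma3_quotient G) (gamma3_proj G)"
    unfolding group_hom_def group_hom_axioms_def
    using N.r_coset_hom_Mod G Gbar by (simp add: gamma3_proj_def[abs_def])
  then have "quadratic_map G QGbar (qbar \<circ> gamma3_proj G)"
    by (rule quadratic_map_hom_comp) (rule qbar.quadratic_axioms)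
  note lift = quadratic_lift[OF G U qbar.H.is_group this]
  have Qpi: "Qpi \<in> hom QG QGbar" and Qpi_q: "\<And>x. x \<in> carrier G \<Longrightarrow> Qpi (q x) = qbar (gamma3_proj G x)"
    unfolding Qpi_def Q_map_def using lift by auto

  \<comment> \<open>Passing to \<open>H\<close> modulo \<open>gamma3 H\<close> makes commutators
    central in the target, so the composite kills \<open>gamma3 G\<close>; this puts
    \<open>f\<close> of \<open>gamma3 G\<close> inside \<open>gamma3 H\<close> and lets the
    composite descend to the quotient of \<open>G\<close>.\<close>
  have quad: "quadratic G (gamma3_quotient H) (gamma3_proj H \<circ> f)"
    using quadratic_map_comp_hom[OF G H Hbar f projH] by (simp add: quadratic_def quadratic_axioms_def G Hbar)
  have triv: "(gamma3_proj H \<circ> f) x = \<one>\<^bsub>gamma3_quotient H\<^esub>" if "x \<in> gamma3 G" for x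
    using quadratic.image_gamma3_trivial[OF quad f.H.commutators_central_mod_gamma3 that] .
  have f_gamma3: "f x \<in> gamma3 H" if "x \<in> gamma3 G" for x
    using triv[OF that] that by (simp add: gamma3_proj_def NH.coset_one_iff)
  \<comment> \<open>The left vertical map is \<open>f\<close> itself on
    \<open>gamma3 G\<close>.\<close>
  have f3: "f \<in> hom (gamma3_group G) (gamma3_group H)"
    using f.hom_gamma3 f_gamma3 by (simp add: hom_def Pi_iff)

  obtain g where g: "quadratic_map (gamma3_quotient G) (gamma3_quotient H) g"
    and gf: "\<And>x. x \<in> carrier G \<Longrightarrow> g (gamma3 G #>\<^bsub>G\<^esub> x) = gamma3_proj H (f x)"
    using quadratic_descend[OF quad N.normal_axioms f.G.gamma3_subset_derived triv] by auto
  define fbarbar where "fbarbar = quadratic_lift (gamma3_quotient G) QGbar qbar (gamma3_quotient H) g"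
  have fbarbar: "fbarbar \<in> hom QGbar (gamma3_quotient H)"
    and fbarbar_q: "\<And>A. A \<in> carrier (gamma3_quotient G) \<Longrightarrow> fbarbar (qbar A) = g A"
    unfolding fbarbar_def using quadratic_lift[OF Gbar Ubar Hbar g] by blast+
  \<comment> \<open>Commutativity of the right square is checked at \<open>q x\<close>, where both
    composites give the projection of \<open>f x\<close>.\<close>
  have "(fbarbar \<circ> Qpi) y = (gamma3_proj H \<circ> fbar) y" if y: "y \<in> carrier QG" for y
    by (rule universal_hom_eq[OF G U Hbar hom_compose[OF Qpi fbarbar] hom_compose[OF fbar projH] _ y])
      (simp add: Qpi_q fbar_q fbarbar_q proj_closed, simp add: gamma3_proj_def gf)
  moreover have "fbar (q x) = f x" if "x \<in> gamma3 G" for x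
    using that by (simp add: fbar_q)
  ultimately show ?thesis
    using fbar fbar_q Qpi_q f3 fbarbar Q_gamma3_short_exact[OF G U Ubar Qpi Qpi_q]
      gamma3_short_exact[OF H] by (intro conjI exI[of _ f] exI[of _ fbarbar]) auto
qed

end
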